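(* Let $S$ be a densely defined closed symmetric operator in a complex Hilbert space $\mathfrak H$ with $n_+\neq0$. For $\mu,z\in\mathbb C_+=\{\lambda\in\mathbb C:\mathrm{Im}\,\lambda>0\}$ define a linear operator $S_{\mu,z}$ by $$\mathrm{dom}\,S_{\mu,z}=\left(P_{\mathfrak M_{\bar z}}+\sqrt{\tfrac{\mathrm{Im}\,z}{\mathrm{Im}\,\mu}}\,P_{\mathfrak N_z}\right)\mathrm{dom}\,S,$$ $$S_{\mu,z}\left(P_{\mathfrak M_{\bar z}}+\sqrt{\tfrac{\mathrm{Im}\,z}{\mathrm{Im}\,\mu}}\,P_{\mathfrak N_z}\right)f_S=\left(P_{\mathfrak M_{\bar z}}+\frac{\bar\mu}{\bar z}\sqrt{\tfrac{\mathrm{Im}\,z}{\mathrm{Im}\,\mu}}\,P_{\mathfrak N_z}\right)Sf_S,\qquad f_S\in\mathrm{dom}\,S.$$ Then $S_{\mu,z}$ is symmetric, densely defined and closed, and: (1) for at least one pair $\{\mu,z\}$ (then for all) $\mathrm{dom}\,S_{\mu,z}^2$ is a core of $S_{\mu,z}$ if and only if $\mathrm{dom}\,S^2$ is a core of $S$; (2) for at least one pair $\{\mu,z\}$ (then for all) $\mathrm{dom}\,S_{\mu,z}^2$ is dense in $\mathfrak H$ but not a core of $S_{\mu,z}$ if and only if $\mathrm{dom}\,S^2$ is dense in $\mathfrak H$ but not a core of $S$; (3) for at least one pair $\{\mu,z\}$ (then for all) $\mathrm{dom}\,S_{\mu,z}^2$ is non-dense in $\mathfrak H$ if and only if $\mathrm{dom}\,S^2$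 is non-dense in $\mathfrak H$; (4) for at least one pair $\{\mu,z\}$ (then for all) $\mathrm{dom}\,S_{\mu,z}^2=\{0\}$ if and only if $\mathrm{dom}\,S^2=\{0\}$. Here, in each item, "for at least one pair (then for all)" means that the property of $S_{\mu,z}$ holds for some $\mu,z\in\mathbb C_+$ if and only if it holds for all $\mu,z\in\mathbb C_+$, and this is equivalent to the stated property of $S$.
   Context: For a closed symmetric operator $S$ and $\lambda\in\mathbb C\setminus\mathbb R$: $\mathfrak M_\lambda=\mathrm{ran}(S-\lambda I)$ (a closed subspace) and $\mathfrak N_\lambda=\mathfrak M_{\bar\lambda}^\perp$; thus $\mathfrak H=\mathfrak M_{\bar z}\oplus\mathfrak N_z$. The number $n_+=\dim\mathfrak N_\lambda$, $\mathrm{Im}\,\lambda>0$, is the deficiency index of $S$ in the upper half-plane. $P_{\mathfrak L}$ is the orthogonal projection onto a closed subspace $\mathfrak L$. For an operator $A$, $\mathrm{dom}\,A^2=\{f\in\mathrm{dom}\,A:Af\in\mathrm{dom}\,A\}$. A core of a closed operator $A$ is a linear manifold in $\mathrm{dom}\,A$ that is dense in $\mathrm{dom}\,A$ with respect to the graph norm. *)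

theory Defs
  imports "HOL-Analysis.Analysis" "HOL-Library.Extended_Nat"
begin

text \<open>The imported theories only provide real inner product spaces; a complex inner product space
  is introduced as one whose real inner product is the real part of a complex one, so that the norm,
  the topology and completeness are the library's. The form \<^term>\<open>cinner\<close> is linear in its first
  argument and positive definite because \<^term>\<open>inner\<close> is.\<close>

class complex_vector = real_vector +
  fixes scaleC :: "complex \<Rightarrow> 'a \<Rightarrow> 'a" (infixr "*\<^sub>C" 75)
  assumes scaleC_add_right: "a *\<^sub>C (x + y) = a *\<^sub>C x + a *\<^sub>C y"
    and scaleC_add_left: "(a + b) *\<^sub>C x = a *\<^sub>C x + b *\<^sub>C x"
    and scaleC_scaleC: "a *\<^sub>C b *\<^sub>C x = (a * b) *\<^sub>C x"
    and scaleC_of_real: "complex_of_real r *\<^sub>C x = r *\<^sub>R x"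

lemma scaleC_one: "1 *\<^sub>C x = (x :: 'a :: complex_vector)"
  using scaleC_of_real[of 1 x] by simp

class complex_inner = complex_vector + real_inner +
  fixes cinner :: "'a \<Rightarrow> 'a \<Rightarrow> complex"
  assumes cinner_commute: "cinner x y = cnj (cinner y x)"
    and cinner_add_left: "cinner (x + y) w = cinner x w + cinner y w"
    and cinner_scaleC_left: "cinner (a *\<^sub>C x) y = a * cinner x y"
    and inner_eq_Re_cinner: "inner x y = Re (cinner x y)"

class chilbert_space = complex_inner + complete_space

instantiation complex :: chilbert_space
begin

definition scaleC_complex :: "complex \<Rightarrow> complex \<Rightarrow> complex" where
  "scaleC_complex a x = a * x"

definition cinner_complex :: "complex \<Rightarrow> complex \<Rightarrow> complex" where
  "cinner_complex x y = x * cnj y"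

instance
  by standard (auto simp: scaleC_complex_def cinner_complex_def algebra_simps
      scaleR_conv_of_real inner_complex_def)

end

instantiation prod :: (complex_vector, complex_vector) complex_vector
begin

definition scaleC_prod :: "complex \<Rightarrow> 'a \<times> 'b \<Rightarrow> 'a \<times> 'b" where
  "scaleC_prod a p = (a *\<^sub>C fst p, a *\<^sub>C snd p)"

instance
  by standard (auto simp: scaleC_prod_def scaleC_add_right scaleC_add_left scaleC_scaleC
      scaleC_of_real scaleR_prod_def)

end

global_interpretation complex_vector:
  vector_space "scaleC :: complex \<Rightarrow> 'a \<Rightarrow> 'a :: complex_vector"
  defines csubspace = complex_vector.subspace
    and cdependent = complex_vector.dependent
  by standard (simp_all add: scaleC_add_right scaleC_add_left scaleC_scaleC scaleC_one)

text \<open>The dimension takes the value \<^term>\<open>\<infinity>\<close> on infinite-dimensional subspaces, where the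
  dimension of the library's \<^locale>\<open>vector_space\<close> would be 0.\<close>

definition cdim :: "'a :: complex_vector set \<Rightarrow> enat" where
  "cdim L = (SUP B \<in> {B. B \<subseteq> L \<and> finite B \<and> \<not> cdependent B}. enat (card B))"

definition orth_compl :: "'a :: complex_inner set \<Rightarrow> 'a set" where
  "orth_compl L = {x. \<forall>y\<in>L. cinner x y = 0}"

definition orth_proj :: "'a :: complex_inner set \<Rightarrow> 'a \<Rightarrow> 'a" where
  "orth_proj L x = (THE y. y \<in> L \<and> x - y \<in> orth_compl L)"

text \<open>A (possibly unbounded) operator is identified with its graph
  \<open>{(f, A f) | f. f \<in> dom A}\<close>: its domain is the library's \<^term>\<open>Domain\<close>, and it is closed
  iff its graph is \<^term>\<open>closed\<close> in the product topology.\<close>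

type_synonym 'a operator = "('a \<times> 'a) set"

definition linear_operator :: "'a :: complex_vector operator \<Rightarrow> bool" where
  "linear_operator A \<longleftrightarrow> single_valued A \<and> csubspace A"

definition dense :: "'a :: topological_space set \<Rightarrow> bool" where
  "dense D \<longleftrightarrow> closure D = UNIV"

definition symmetric_operator :: "'a :: complex_inner operator \<Rightarrow> bool" where
  "symmetric_operator A \<longleftrightarrow>
     (\<forall>(f, Af) \<in> A. \<forall>(g, Ag) \<in> A. cinner Af g = cinner f Ag)"

definition dom_square :: "'a operator \<Rightarrow> 'a set" where
  "dom_square A = {f. \<exists>Af. (f, Af) \<in> A \<and> Af \<in> Domain A}"

text \<open>The norm of \<open>(f, A f)\<close> in the product space is the graph norm
  \<open>sqrt ((norm f)\<^sup>2 + (norm (A f))\<^sup>2)\<close> of \<open>f\<close>, so density of \<open>D\<close> in the domain with respect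
  to the graph norm is density of the graph of the restriction to \<open>D\<close> in the graph of \<open>A\<close>.\<close>

definition is_core :: "'a :: complex_inner set \<Rightarrow> 'a operator \<Rightarrow> bool" where
  "is_core D A \<longleftrightarrow>
     csubspace D \<and> D \<subseteq> Domain A \<and> A \<subseteq> closure {(f, Af). (f, Af) \<in> A \<and> f \<in> D}"

definition ran_shift :: "'a :: complex_inner operator \<Rightarrow> complex \<Rightarrow> 'a set" where
  "ran_shift S \<zeta> = {Sf - \<zeta> *\<^sub>C f | f Sf. (f, Sf) \<in> S}"

definition defect_space :: "'a :: complex_inner operator \<Rightarrow> complex \<Rightarrow> 'a set" where
  "defect_space S \<zeta> = orth_compl (ran_shift S (cnj \<zeta>))"

definition upper_half_plane :: "complex set" where
  "upper_half_plane = {\<zeta>. Im \<zeta> > 0}"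

text \<open>For a closed symmetric operator the dimension of the defect space is constant on the open
  upper half-plane, so the description below has a unique solution.\<close>

definition upper_deficiency_index :: "'a :: complex_inner operator \<Rightarrow> enat" where
  "upper_deficiency_index S =
     (THE n. \<forall>\<zeta> \<in> upper_half_plane. cdim (defect_space S \<zeta>) = n)"

definition defect_scaling ::
    "'a :: complex_inner operator \<Rightarrow> complex \<Rightarrow> complex \<Rightarrow> 'a \<Rightarrow> 'a" where
  "defect_scaling S z c x =
     orth_proj (ran_shift S (cnj z)) x + c *\<^sub>C orth_proj (defect_space S z) x"

definition transformed_operator ::
    "'a :: complex_inner operator \<Rightarrow> complex \<Rightarrow> complex \<Rightarrow> 'a operator" where
  "transformed_operator S \<mu> z =
     {(defect_scaling S z (complex_of_real (sqrt (Im z / Im \<mu>))) f,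
       defect_scaling S z (cnj \<mu> / cnj z * complex_of_real (sqrt (Im z / Im \<mu>))) Sf)
      | f Sf. (f, Sf) \<in> S}"

end

theory Submission
  imports Defs
begin

text \<open>Fix \<open>\<mu>, z\<close> in the upper half-plane, let \<open>M = ran (S - cnj z)\<close> with orthogonal projection
  \<open>P\<close>, and let \<open>T = S\<^bsub>\<mu>,z\<^esub>\<close>. The idea is that \<open>S\<close> and \<open>T\<close>, together with their squares, are
  related by a homeomorphism, so that density, triviality and the core property are carried over
  one by one.

  The map \<open>V c = P + c (1 - P)\<close> is invertible for \<open>c \<noteq> 0\<close>, and the graph of \<open>T\<close> is by
  definition the image of the graph of \<open>S\<close> under \<open>V c \<times> V c'\<close>; hence \<open>T\<close> is closed, linear and
  densely defined. Every \<open>f \<in> dom S\<close> satisfies \<open>(1 - P) S f = cnj z (1 - P) f\<close>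
  (\<open>defect_part_of_image\<close>), because \<open>(S - cnj z) f \<in> M\<close>. So the passage from \<open>S\<close> to \<open>T\<close> changes the
  imaginary part of the form by a multiple of \<open>Im z - \<bar>c\<bar>\<^sup>2 Im \<mu>\<close>, which vanishes for the chosen
  \<open>c\<close>: \<open>T\<close> is symmetric.

  The same identity gives \<open>dom T\<^sup>2 = V c D\<close> with
  \<open>D = {f \<in> dom S. S f + w (1 - P) f \<in> dom S}\<close> and \<open>w = cnj \<mu> - cnj z\<close> (\<open>dom_square_T\<close>). In
  general \<open>D\<close> is not \<open>dom S\<^sup>2\<close>, but it is its preimage under a homeomorphism. Put
  \<open>B = (S - cnj z)\<^sup>-\<^sup>1 P\<close> and \<open>W = 1 - w B\<close>. As \<open>B\<close> has its values in \<open>dom S\<close> and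
  \<open>(S - cnj z) B = P\<close>, a vector \<open>f\<close> lies in \<open>dom S\<close> iff \<open>W f\<close> does, and
  \<open>S W f = (S f + w (1 - P) f) - (w f + w (cnj z) B f)\<close>, where the second bracket lies in \<open>dom S\<close>.
  Hence \<open>W D = dom S\<^sup>2\<close> (\<open>dom_square_eq\<close>). The map \<open>f \<mapsto> (W f, S W f)\<close> is likewise
  controlled by \<open>f\<close> and \<open>S f\<close> (\<open>W_graph\<close>), so it is compatible with graph norms too.

  What remains is that \<open>W\<close> is invertible (\<open>W_surj\<close>, \<open>W_bounded_below\<close>), and this is where both
  points have to lie in the same half-plane. On \<open>M\<close>, the operator \<open>1 - (z - cnj z) B\<close> is the
  isometric Cayley transform \<open>(S - z) (S - cnj z)\<^sup>-\<^sup>1\<close>, so its compression \<open>U\<close> to \<open>M\<close> is a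
  contraction, and the compression of \<open>(z - cnj z) W\<close> is \<open>(z - cnj \<mu>) + w U\<close>. Since
  \<open>\<bar>w\<bar> < \<bar>z - cnj \<mu>\<bar>\<close>, this is a contractive perturbation of a multiple of the identity.\<close>

section \<open>Complex inner products\<close>

lemma cinner_add_right: "cinner x (y + w) = cinner x y + cinner x w"
  using cinner_commute[of x] cinner_commute[of _ x] by (metis cinner_add_left complex_cnj_add)

lemma cinner_scaleC_right: "cinner x (a *\<^sub>C y) = cnj a * cinner x y"
  by (metis cinner_commute cinner_scaleC_left complex_cnj_mult)

lemma cinner_diff_left: "cinner (x - y) w = cinner x w - cinner y w"
  using cinner_add_left[of "x - y" y w] by simp

lemma cinner_diff_right: "cinner x (y - w) = cinner x y - cinner x w"
  using cinner_add_right[of x "y - w" w] by simp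

lemma cinner_zero_left [simp]: "cinner 0 x = 0"
  using cinner_add_left[of 0 0 x] by simp

lemma cinner_self: "cinner x x = complex_of_real ((norm x)\<^sup>2)"
proof (rule complex_eqI)
  show "Re (cinner x x) = Re (complex_of_real ((norm x)\<^sup>2))"
    by (simp add: inner_eq_Re_cinner[symmetric] power2_norm_eq_inner)
  show "Im (cinner x x) = Im (complex_of_real ((norm x)\<^sup>2))"
    using arg_cong[OF cinner_commute[of x x], of Im] by simp
qed

lemma norm_scaleC: "norm (a *\<^sub>C x) = cmod a * norm (x :: 'a :: complex_inner)"
proof (rule power2_eq_imp_eq)
  have "complex_of_real ((norm (a *\<^sub>C x))\<^sup>2) = a * (cnj a * complex_of_real ((norm x)\<^sup>2))"
    by (simp only: cinner_self[symmetric] cinner_scaleC_left cinner_scaleC_right mult.left_commute)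
  also have "\<dots> = complex_of_real ((cmod a * norm x)\<^sup>2)"
    by (simp add: mult.assoc[symmetric] complex_norm_square[symmetric] power_mult_distrib
        flip: of_real_power)
  finally show "(norm (a *\<^sub>C x))\<^sup>2 = (cmod a * norm x)\<^sup>2"
    by (simp only: of_real_eq_iff)
qed auto

lemma scaleC_scaleR: "a *\<^sub>C (r *\<^sub>R x) = r *\<^sub>R (a *\<^sub>C x)"
  by (metis mult.commute scaleC_of_real scaleC_scaleC)

lemma bounded_linear_scaleC: "bounded_linear (\<lambda>x. a *\<^sub>C (x :: 'a :: complex_inner))"
  by (rule bounded_linear_intro[where K = "cmod a"])
    (simp_all add: scaleC_add_right norm_scaleC scaleC_scaleR)

lemma continuous_on_scaleC [continuous_intros]:
  fixes f :: "'b :: topological_space \<Rightarrow> 'a :: complex_inner"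
  shows "continuous_on A f \<Longrightarrow> continuous_on A (\<lambda>x. a *\<^sub>C f x)"
  by (rule bounded_linear.continuous_on[OF bounded_linear_scaleC])

section \<open>Orthogonal projections\<close>

text \<open>The parallelogram law applied to \<open>x - y m\<close> and \<open>x - y n\<close>: if the midpoints are no closer to
  \<open>x\<close> than the infimum \<open>d\<close> of the squared distances, then the points themselves are close together.\<close>

lemma minimizing_sequence_Cauchy:
  fixes y :: "nat \<Rightarrow> 'a :: real_inner"
  assumes mid: "\<And>m n. d \<le> (norm (x - (1/2) *\<^sub>R (y m + y n)))\<^sup>2"
    and y: "\<And>n. (norm (x - y n))\<^sup>2 < d + inverse (real (Suc n))"
  shows "Cauchy y"
proof (rule CauchyI)
  fix e :: real assume e: "e > 0"
  obtain N where N: "inverse (real (Suc N)) < e\<^sup>2 / 4"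
    using reals_Archimedean[of "e\<^sup>2 / 4"] e by auto
  have "norm (y m - y n) < e" if "m \<ge> N" "n \<ge> N" for m n
  proof (rule power2_less_imp_less)
    have "(norm (y m - y n))\<^sup>2 =
        2 * (norm (x - y m))\<^sup>2 + 2 * (norm (x - y n))\<^sup>2 - 4 * (norm (x - (1/2) *\<^sub>R (y m + y n)))\<^sup>2"
      unfolding power2_norm_eq_inner by (simp add: algebra_simps inner_commute)
    also have "\<dots> < 4 * inverse (real (Suc N))"
    proof -
      have "2 * A + 2 * B - 4 * C < 4 * r"
        if "A < d + p" "B < d + q" "d \<le> C" "p \<le> r" "q \<le> r" for A B C p q r :: real
        using that by argo
      moreover have "inverse (real (Suc m)) \<le> inverse (real (Suc N))"
        "inverse (real (Suc n)) \<le> inverse (real (Suc N))"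
        using that by (auto intro!: le_imp_inverse_le)
      ultimately show ?thesis using y[of m] y[of n] mid[of m n] by blast
    qed
    also have "\<dots> < e\<^sup>2" using N by simp
    finally show "(norm (y m - y n))\<^sup>2 < e\<^sup>2" .
  qed (use e in simp)
  then show "\<exists>N. \<forall>m\<ge>N. \<forall>n\<ge>N. norm (y m - y n) < e" by blast
qed

text \<open>First variation: otherwise moving \<open>y\<close> by the projection of \<open>x - y\<close> onto the line through \<open>v\<close>
  would shorten the distance to \<open>x\<close>.\<close>

lemma nearest_point_orthogonal:
  fixes x y :: "'a :: real_inner"
  assumes sub: "subspace L" and y: "y \<in> L"
    and near: "\<And>v. v \<in> L \<Longrightarrow> norm (x - y) \<le> norm (x - v)" and v: "v \<in> L"
  shows "inner (x - y) v = 0"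
proof (cases "v = 0")
  case False
  define t where "t = inner (x - y) v / inner v v"
  have vv: "inner v v > 0" using False by simp
  have "y + t *\<^sub>R v \<in> L" using sub y v by (simp add: subspace_add subspace_scale)
  then have "(norm (x - y))\<^sup>2 \<le> (norm (x - (y + t *\<^sub>R v)))\<^sup>2"
    using near by (simp add: power_mono)
  also have "\<dots> = (norm (x - y))\<^sup>2 - 2 * t * inner (x - y) v + t * t * inner v v"
    unfolding power2_norm_eq_inner by (simp add: algebra_simps inner_commute)
  also have "\<dots> = (norm (x - y))\<^sup>2 - (inner (x - y) v)\<^sup>2 / inner v v"
    using vv by (simp add: t_def power2_eq_square field_simps)
  finally have "(inner (x - y) v)\<^sup>2 / inner v v \<le> 0" by simp
  then show ?thesis using vv by (simp add: divide_le_0_iff)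
qed simp

lemma orthogonal_decomposition:
  fixes L :: "'a :: {real_inner, complete_space} set"
  assumes cl: "closed L" and sub: "subspace L"
  shows "\<exists>y \<in> L. \<forall>v \<in> L. inner (x - y) v = 0"
proof -
  define d where "d = (INF v\<in>L. (norm (x - v))\<^sup>2)"
  have ne: "L \<noteq> {}" using subspace_0[OF sub] by auto
  have bdd: "bdd_below ((\<lambda>v. (norm (x - v))\<^sup>2) ` L)" by (rule bdd_belowI[of _ 0]) auto
  have d_le: "d \<le> (norm (x - v))\<^sup>2" if "v \<in> L" for v
    unfolding d_def by (rule cINF_lower[OF bdd that])
  have "\<exists>v\<in>L. (norm (x - v))\<^sup>2 < d + inverse (real (Suc n))" for n
    using cINF_less_iff[OF ne bdd, of "d + inverse (real (Suc n))"] unfolding d_def by simp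
  then obtain y where yL: "\<And>n. y n \<in> L"
    and y: "\<And>n. (norm (x - y n))\<^sup>2 < d + inverse (real (Suc n))" by metis
  have "Cauchy y"
    by (rule minimizing_sequence_Cauchy[OF d_le y]) (simp add: sub yL subspace_add subspace_scale)
  then obtain l where l: "y \<longlonglongrightarrow> l" using Cauchy_convergent_iff convergent_def by blast
  have lL: "l \<in> L" using closed_sequentially[OF cl] yL l by blast
  have lim: "(\<lambda>n. (norm (x - y n))\<^sup>2) \<longlonglongrightarrow> (norm (x - l))\<^sup>2"
    using l by (intro tendsto_intros)
  have d: "(\<lambda>n. d + inverse (real (Suc n))) \<longlonglongrightarrow> d + 0"
    by (intro tendsto_add tendsto_const LIMSEQ_inverse_real_of_nat)
  have "(norm (x - l))\<^sup>2 \<le> d + 0"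
    by (rule LIMSEQ_le[OF lim d]) (use y less_imp_le in blast)
  then have le: "(norm (x - l))\<^sup>2 \<le> d" by simp
  have "norm (x - l) \<le> norm (x - v)" if "v \<in> L" for v
    using order_trans[OF le d_le[OF that]] by (rule power2_le_imp_le) simp
  then show ?thesis using nearest_point_orthogonal[OF sub lL] lL by blast
qed

lemma csubspace_imp_subspace: "csubspace L \<Longrightarrow> subspace L"
  unfolding complex_vector.subspace_def subspace_def by (metis scaleC_of_real)

lemma csubspace_orth_compl: "csubspace (orth_compl L)"
  by (auto simp: complex_vector.subspace_def orth_compl_def cinner_add_left cinner_scaleC_left)

lemma orth_projI:
  assumes L: "csubspace L" and y: "y \<in> L" "x - y \<in> orth_compl L"
  shows "orth_proj L x = y"
  unfolding orth_proj_def
proof (rule the_equality)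
  fix y' assume y': "y' \<in> L \<and> x - y' \<in> orth_compl L"
  have "y' - y \<in> L" using L y y' complex_vector.subspace_diff by blast
  moreover have "y' - y \<in> orth_compl L"
    using complex_vector.subspace_diff[OF csubspace_orth_compl, of "x - y" L "x - y'"] y y' by simp
  ultimately have "cinner (y' - y) (y' - y) = 0" by (simp add: orth_compl_def)
  then show "y' = y" by (simp add: cinner_self)
qed (use y in simp)

text \<open>On a complex subspace, orthogonality for the real inner product, tested against \<open>v\<close> and
  \<open>\<i> v\<close>, gives the real and the imaginary part of complex orthogonality.\<close>

lemma
  fixes L :: "'a :: chilbert_space set"
  assumes L: "closed L" "csubspace L"
  shows orth_proj_in: "orth_proj L x \<in> L"
    and orth_proj_orthogonal: "x - orth_proj L x \<in> orth_compl L"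
proof -
  obtain y where y: "y \<in> L" "\<And>v. v \<in> L \<Longrightarrow> inner (x - y) v = 0"
    using orthogonal_decomposition[OF L(1) csubspace_imp_subspace[OF L(2)]] by blast
  have "cinner (x - y) v = 0" if v: "v \<in> L" for v
  proof (rule complex_eqI)
    show "Re (cinner (x - y) v) = Re 0" using y(2)[OF v] by (simp add: inner_eq_Re_cinner)
    have "\<i> *\<^sub>C v \<in> L" using L(2) v by (rule complex_vector.subspace_scale)
    from y(2)[OF this] show "Im (cinner (x - y) v) = Im 0"
      by (simp add: inner_eq_Re_cinner cinner_scaleC_right)
  qed
  then have y': "x - y \<in> orth_compl L" by (simp add: orth_compl_def)
  then have "orth_proj L x = y" using orth_projI[OF L(2)] y(1) by blast
  then show "orth_proj L x \<in> L" "x - orth_proj L x \<in> orth_compl L" using y y' by auto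
qed

lemma orth_proj_orth_compl:
  fixes L :: "'a :: chilbert_space set"
  assumes L: "closed L" "csubspace L"
  shows "orth_proj (orth_compl L) x = x - orth_proj L x"
proof (rule orth_projI[OF csubspace_orth_compl orth_proj_orthogonal[OF L]])
  have "cinner (orth_proj L x) v = 0" if "v \<in> orth_compl L" for v
    using that orth_proj_in[OF L, of x] cinner_commute[of "orth_proj L x" v]
    by (simp add: orth_compl_def)
  then show "x - (x - orth_proj L x) \<in> orth_compl (orth_compl L)" by (simp add: orth_compl_def)
qed

lemma orth_proj_add:
  fixes L :: "'a :: chilbert_space set"
  assumes L: "closed L" "csubspace L"
  shows "orth_proj L (x + y) = orth_proj L x + orth_proj L y"
proof (rule orth_projI[OF L(2)])
  show "orth_proj L x + orth_proj L y \<in> L"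
    by (intro complex_vector.subspace_add L(2) orth_proj_in L(1))
  show "x + y - (orth_proj L x + orth_proj L y) \<in> orth_compl L"
    using complex_vector.subspace_add[OF csubspace_orth_compl
        orth_proj_orthogonal[OF L, of x] orth_proj_orthogonal[OF L, of y]]
    by (simp add: algebra_simps)
qed

lemma orth_proj_scaleC:
  fixes L :: "'a :: chilbert_space set"
  assumes L: "closed L" "csubspace L"
  shows "orth_proj L (a *\<^sub>C x) = a *\<^sub>C orth_proj L x"
proof (rule orth_projI[OF L(2)])
  show "a *\<^sub>C orth_proj L x \<in> L"
    by (intro complex_vector.subspace_scale L(2) orth_proj_in L(1))
  show "a *\<^sub>C x - a *\<^sub>C orth_proj L x \<in> orth_compl L"
    using complex_vector.subspace_scale[OF csubspace_orth_compl orth_proj_orthogonal[OF L, of x], of a]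
    by (simp add: complex_vector.scale_right_diff_distrib)
qed

lemma norm_orth_proj_le:
  fixes L :: "'a :: chilbert_space set"
  assumes L: "closed L" "csubspace L"
  shows "norm (orth_proj L x) \<le> norm x"
proof -
  have "inner (x - orth_proj L x) (orth_proj L x) = 0"
    using orth_proj_orthogonal[OF L, of x] orth_proj_in[OF L, of x]
    by (simp add: orth_compl_def inner_eq_Re_cinner)
  then have "(norm x)\<^sup>2 = (norm (x - orth_proj L x))\<^sup>2 + (norm (orth_proj L x))\<^sup>2"
    unfolding power2_norm_eq_inner by (simp add: algebra_simps inner_commute)
  then show ?thesis by (auto intro: power2_le_imp_le[OF _ norm_ge_zero])
qed

section \<open>Transport along homeomorphisms\<close>

lemma closure_homeomorphic_image:
  assumes J: "continuous_on UNIV J" and J': "continuous_on UNIV J'"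
    and inv: "\<And>x. J' (J x) = x" "\<And>y. J (J' y) = y"
  shows "closure (J ` D) = J ` closure D"
proof
  show "J ` closure D \<subseteq> closure (J ` D)"
    by (rule image_closure_subset[OF continuous_on_subset[OF J]]) (auto intro: closure_subset[THEN subsetD])
  have "J' ` closure (J ` D) \<subseteq> closure D"
    by (rule image_closure_subset[OF continuous_on_subset[OF J']])
      (auto simp: inv intro: closure_subset[THEN subsetD])
  then show "closure (J ` D) \<subseteq> J ` closure D" using inv(2) by (metis image_eqI image_subset_iff subsetI)
qed

lemma dense_homeomorphic_image:
  assumes "continuous_on UNIV J" "continuous_on UNIV J'"
    and inv: "\<And>x. J' (J x) = x" "\<And>y. J (J' y) = y"
  shows "dense (J ` D) \<longleftrightarrow> dense D"
proof -
  have bij: "bij J" using inv by (metis bijI')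
  have "J ` X = UNIV \<longleftrightarrow> X = UNIV" for X
    using bij by (metis bij_betw_def inj_image_eq_iff)
  then show ?thesis unfolding dense_def closure_homeomorphic_image[OF assms] .
qed

definition graph_restrict :: "'a operator \<Rightarrow> 'a set \<Rightarrow> 'a operator" where
  "graph_restrict A D = {(f, g). (f, g) \<in> A \<and> f \<in> D}"

text \<open>The inclusion \<open>A \<subseteq> closure (graph_restrict A D)\<close> is the density part of the core property. It
  is transported by homeomorphisms of the product space that send the first component to a function
  of the first component alone, so that restricting the domain commutes with them.\<close>

lemma graph_dense_homeomorphic_image:
  fixes \<Theta> :: "'a :: topological_space \<times> 'a \<Rightarrow> 'a \<times> 'a"
  assumes "continuous_on UNIV \<Theta>" "continuous_on UNIV \<Theta>'"
    and inv: "\<And>p. \<Theta>' (\<Theta> p) = p" "\<And>p. \<Theta> (\<Theta>' p) = p"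
    and fst: "\<And>p. fst (\<Theta> p) = J (fst p)" and J: "inj J"
  shows "\<Theta> ` A \<subseteq> closure (graph_restrict (\<Theta> ` A) (J ` D)) \<longleftrightarrow> A \<subseteq> closure (graph_restrict A D)"
proof -
  have "inj \<Theta>" using inv by (metis injI)
  moreover have "graph_restrict (\<Theta> ` A) (J ` D) = \<Theta> ` graph_restrict A D"
  proof -
    have "graph_restrict A D = {p \<in> A. fst p \<in> D}" for A and D :: "'a set"
      by (auto simp: graph_restrict_def)
    then show ?thesis by (auto simp: fst dest!: injD[OF J])
  qed
  ultimately show ?thesis
    by (simp add: closure_homeomorphic_image[OF assms(1-4)] inj_image_subset_iff)
qed

lemma csubspace_dom_square:
  assumes "linear_operator A" shows "csubspace (dom_square A)"
proof -
  have A: "csubspace A" using assms by (simp add: linear_operator_def)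
  have add: "(f + f', g + g') \<in> A" if "(f, g) \<in> A" "(f', g') \<in> A" for f g f' g'
    using complex_vector.subspace_add[OF A that] by simp
  have scale: "(a *\<^sub>C f, a *\<^sub>C g) \<in> A" if "(f, g) \<in> A" for a f g
    using complex_vector.subspace_scale[OF A that] by (simp add: scaleC_prod_def)
  have "(0, 0) \<in> A" using complex_vector.subspace_0[OF A] by (simp add: zero_prod_def)
  then show ?thesis
    unfolding complex_vector.subspace_def dom_square_def
    by (safe; (blast intro: add scale))
qed

lemma is_core_dom_square:
  assumes "linear_operator A"
  shows "is_core (dom_square A) A \<longleftrightarrow> A \<subseteq> closure (graph_restrict A (dom_square A))"
  using csubspace_dom_square[OF assms]
  by (auto simp: is_core_def graph_restrict_def dom_square_def)

section \<open>The shifted operator and its inverse\<close>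

text \<open>By symmetry, \<open>g - (Re \<zeta>) f\<close> and \<open>\<i> (Im \<zeta>) f\<close> are orthogonal for the real inner product. The
  identity yields both the lower bound for \<open>S - \<zeta>\<close> and the equality of the norms of \<open>(S - \<zeta>) f\<close> and
  \<open>(S - cnj \<zeta>) f\<close>, which makes the Cayley transform isometric.\<close>

lemma norm_shift:
  assumes "symmetric_operator S" and "(f, g) \<in> S"
  shows "(norm (g - \<zeta> *\<^sub>C f))\<^sup>2 = (norm (g - complex_of_real (Re \<zeta>) *\<^sub>C f))\<^sup>2 + (Im \<zeta>)\<^sup>2 * (norm f)\<^sup>2"
proof -
  have sym: "cinner g f = cinner f g" using assms by (auto simp: symmetric_operator_def)
  have "complex_of_real ((norm (g - \<zeta> *\<^sub>C f))\<^sup>2) =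
      complex_of_real ((norm (g - complex_of_real (Re \<zeta>) *\<^sub>C f))\<^sup>2 + (Im \<zeta>)\<^sup>2 * (norm f)\<^sup>2)"
    unfolding of_real_add of_real_mult cinner_self[symmetric]
    by (simp add: cinner_diff_left cinner_diff_right cinner_scaleC_left cinner_scaleC_right sym
        complex_eq_iff power2_eq_square algebra_simps)
  then show ?thesis by (simp only: of_real_eq_iff)
qed

text \<open>The equation is the fixed point equation of \<open>y \<mapsto> (x - b U y) / a\<close>.\<close>

lemma perturbed_identity_surj:
  fixes U :: "'a :: chilbert_space \<Rightarrow> 'a"
  assumes U: "\<And>x y. norm (U x - U y) \<le> norm (x - y)" and ab: "cmod b < cmod a"
  shows "\<exists>y. a *\<^sub>C y + b *\<^sub>C U y = x"
proof -
  have a: "a \<noteq> 0" using ab by auto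
  define F where "F y = (1 / a) *\<^sub>C (x - b *\<^sub>C U y)" for y
  have "dist (F u) (F v) \<le> cmod b / cmod a * dist u v" for u v
  proof -
    have "F u - F v = (- b / a) *\<^sub>C (U u - U v)"
      by (simp add: F_def complex_vector.scale_right_diff_distrib scaleC_scaleC)
    then show ?thesis
      using U[of u v] by (simp add: dist_norm norm_scaleC norm_divide divide_right_mono mult_left_mono)
  qed
  then obtain y where y: "F y = y"
    using banach_fix_type[of "cmod b / cmod a" F] ab a by (auto simp: divide_less_eq)
  have "a *\<^sub>C F y = x - b *\<^sub>C U y" using a by (simp add: F_def scaleC_scaleC scaleC_one)
  then show ?thesis using y by (metis diff_add_cancel)
qed

locale shifted_symmetric_operator =
  fixes S :: "'a :: chilbert_space operator" and z :: complex
  assumes linear: "linear_operator S" and closed: "closed S" and symmetric: "symmetric_operator S"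
    and Im_pos: "Im z > 0"
begin

lemma graph_add: "(f, g) \<in> S \<Longrightarrow> (f', g') \<in> S \<Longrightarrow> (f + f', g + g') \<in> S"
  using complex_vector.subspace_add[of S] linear by (force simp: linear_operator_def)

lemma graph_scale: "(f, g) \<in> S \<Longrightarrow> (a *\<^sub>C f, a *\<^sub>C g) \<in> S"
  using complex_vector.subspace_scale[of S] linear by (force simp: linear_operator_def scaleC_prod_def)

lemma graph_diff: "(f, g) \<in> S \<Longrightarrow> (f', g') \<in> S \<Longrightarrow> (f - f', g - g') \<in> S"
  using complex_vector.subspace_diff[of S] linear by (force simp: linear_operator_def)

lemma graph_zero: "(0, 0) \<in> S"
  using complex_vector.subspace_0[of S] linear by (simp add: linear_operator_def zero_prod_def)

lemma graph_single: "(f, g) \<in> S \<Longrightarrow> (f, g') \<in> S \<Longrightarrow> g = g'"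
  using linear by (auto simp: linear_operator_def single_valued_def)

definition M where "M = ran_shift S (cnj z)"
definition P where "P = orth_proj M"

lemma csubspace_M: "csubspace M"
  unfolding complex_vector.subspace_def M_def ran_shift_def
proof (intro conjI ballI allI)
  show "0 \<in> {Sf - cnj z *\<^sub>C f |f Sf. (f, Sf) \<in> S}"
    using graph_zero by (intro CollectI exI[of _ 0]) simp
next
  fix x y assume "x \<in> {Sf - cnj z *\<^sub>C f |f Sf. (f, Sf) \<in> S}" "y \<in> {Sf - cnj z *\<^sub>C f |f Sf. (f, Sf) \<in> S}"
  then obtain f g f' g' where fg: "(f, g) \<in> S" "(f', g') \<in> S"
    and xy: "x = g - cnj z *\<^sub>C f" "y = g' - cnj z *\<^sub>C f'" by auto
  have "x + y = (g + g') - cnj z *\<^sub>C (f + f')" by (simp add: xy scaleC_add_right)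
  then show "x + y \<in> {Sf - cnj z *\<^sub>C f |f Sf. (f, Sf) \<in> S}" using graph_add[OF fg] by blast
next
  fix c x assume "x \<in> {Sf - cnj z *\<^sub>C f |f Sf. (f, Sf) \<in> S}"
  then obtain f g where fg: "(f, g) \<in> S" and x: "x = g - cnj z *\<^sub>C f" by auto
  have "c *\<^sub>C x = c *\<^sub>C g - cnj z *\<^sub>C (c *\<^sub>C f)"
    by (simp add: x complex_vector.scale_right_diff_distrib scaleC_scaleC mult.commute)
  then show "c *\<^sub>C x \<in> {Sf - cnj z *\<^sub>C f |f Sf. (f, Sf) \<in> S}" using graph_scale[OF fg] by blast
qed

lemma norm_shift_ge: "(f, g) \<in> S \<Longrightarrow> Im z * norm f \<le> norm (g - cnj z *\<^sub>C f)"
  using norm_shift[OF symmetric, of f g "cnj z"] Im_pos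
  by - (rule power2_le_imp_le, auto simp: power_mult_distrib)

text \<open>If \<open>(S - cnj z) f\<^sub>n\<close> converges then \<open>f\<^sub>n\<close> converges by \<open>norm_shift_ge\<close>, hence so does \<open>S f\<^sub>n\<close>,
  and the closedness of \<open>S\<close> applies.\<close>

lemma closed_M: "closed M"
proof (unfold closed_sequential_limits, intro allI impI, elim conjE)
  fix x l assume x: "\<forall>n. x n \<in> M" and l: "x \<longlonglongrightarrow> l"
  then have "\<forall>n. \<exists>f g. (f, g) \<in> S \<and> x n = g - cnj z *\<^sub>C f"
    unfolding M_def ran_shift_def by blast
  then obtain f g where fg: "\<And>n. (f n, g n) \<in> S" and x: "\<And>n. x n = g n - cnj z *\<^sub>C f n" by metis
  have "Cauchy f"
  proof (rule CauchyI)
    fix e :: real assume e: "e > 0"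
    then obtain N where N: "\<And>m n. m \<ge> N \<Longrightarrow> n \<ge> N \<Longrightarrow> norm (x m - x n) < Im z * e"
      using CauchyD[OF LIMSEQ_imp_Cauchy[OF l], of "Im z * e"] Im_pos by auto
    have "norm (f m - f n) < e" if "m \<ge> N" "n \<ge> N" for m n
    proof -
      have "x m - x n = (g m - g n) - cnj z *\<^sub>C (f m - f n)"
        by (simp add: x complex_vector.scale_right_diff_distrib)
      then have "Im z * norm (f m - f n) < Im z * e"
        using norm_shift_ge[OF graph_diff[OF fg[of m] fg[of n]]] N[OF that] by simp
      then show ?thesis using Im_pos by simp
    qed
    then show "\<exists>N. \<forall>m\<ge>N. \<forall>n\<ge>N. norm (f m - f n) < e" by blast
  qed
  then obtain f0 where f0: "f \<longlonglongrightarrow> f0" using Cauchy_convergent_iff convergent_def by blast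
  have "g = (\<lambda>n. x n + cnj z *\<^sub>C f n)" by (simp add: x)
  then have g0: "g \<longlonglongrightarrow> l + cnj z *\<^sub>C f0"
    using tendsto_add[OF l bounded_linear.tendsto[OF bounded_linear_scaleC f0]] by simp
  have "(f0, l + cnj z *\<^sub>C f0) \<in> S"
    using closed_sequentially[OF closed, of "\<lambda>n. (f n, g n)"] fg tendsto_Pair[OF f0 g0] by blast
  then show "l \<in> M" by (force simp: M_def ran_shift_def)
qed

lemmas P_in = orth_proj_in[OF closed_M csubspace_M, folded P_def]
  and P_orthogonal = orth_proj_orthogonal[OF closed_M csubspace_M, folded P_def]
  and P_add = orth_proj_add[OF closed_M csubspace_M, folded P_def]
  and P_scale = orth_proj_scaleC[OF closed_M csubspace_M, folded P_def]
  and norm_P_le = norm_orth_proj_le[OF closed_M csubspace_M, folded P_def]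

lemma P_diff: "P (x - y) = P x - P y"
  using P_add[of "x - y" y] by simp

lemma P_id: "x \<in> M \<Longrightarrow> P x = x"
  unfolding P_def using csubspace_orth_compl[of M]
  by (intro orth_projI[OF csubspace_M]) (auto dest: complex_vector.subspace_0)

lemma P_P [simp]: "P (P x) = P x" by (rule P_id[OF P_in])

lemma bounded_linear_P: "bounded_linear P"
proof (rule bounded_linear_intro[where K = 1])
  show "P (r *\<^sub>R x) = r *\<^sub>R P x" for r x using P_scale[of "complex_of_real r"] by (simp add: scaleC_of_real)
qed (simp_all add: P_add norm_P_le)

lemma continuous_on_P [continuous_intros]: "continuous_on A f \<Longrightarrow> continuous_on A (\<lambda>x. P (f x))"
  by (rule bounded_linear.continuous_on[OF bounded_linear_P])

lemma P_shift: "(f, g) \<in> S \<Longrightarrow> P (g - cnj z *\<^sub>C f) = g - cnj z *\<^sub>C f"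
  by (rule P_id) (auto simp: M_def ran_shift_def)

text \<open>On the defect space, \<open>S\<close> acts as multiplication by \<open>cnj z\<close>. All computations with the transformed
  operator rest on this.\<close>

lemma defect_part_of_image: "(f, g) \<in> S \<Longrightarrow> g - P g = cnj z *\<^sub>C (f - P f)"
  using P_shift[of f g] by (simp add: P_diff P_scale complex_vector.scale_right_diff_distrib algebra_simps)

text \<open>The inverse of \<open>S - cnj z\<close> on its range \<open>M\<close>, extended by zero on the defect space.\<close>

definition B where "B x = (THE f. (f, P x + cnj z *\<^sub>C f) \<in> S)"

lemma shift_injective:
  assumes "(f, x + cnj z *\<^sub>C f) \<in> S" "(f', x + cnj z *\<^sub>C f') \<in> S"
  shows "f = f'"
proof -
  have "Im z * norm (f - f') \<le> 0"
    using norm_shift_ge[OF graph_diff[OF assms]] by (simp add: complex_vector.scale_right_diff_distrib)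
  then show ?thesis using Im_pos by (simp add: mult_le_0_iff)
qed

lemma B_in: "(B x, P x + cnj z *\<^sub>C B x) \<in> S"
proof -
  obtain f g where "(f, g) \<in> S" "P x = g - cnj z *\<^sub>C f"
    using P_in[of x] by (auto simp: M_def ran_shift_def)
  then have f: "(f, P x + cnj z *\<^sub>C f) \<in> S" by simp
  then show ?thesis unfolding B_def by (rule theI) (rule shift_injective[OF _ f])
qed

lemma B_eqI: "(f, P x + cnj z *\<^sub>C f) \<in> S \<Longrightarrow> B x = f"
  by (rule shift_injective[OF B_in])

lemma B_P [simp]: "B (P x) = B x"
  by (simp add: B_def)

lemma B_add: "B (x + y) = B x + B y"
  using graph_add[OF B_in[of x] B_in[of y]]
  by (intro B_eqI) (simp add: P_add scaleC_add_right algebra_simps)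

lemma B_scale: "B (a *\<^sub>C x) = a *\<^sub>C B x"
  using graph_scale[OF B_in[of x], of a]
  by (intro B_eqI) (simp add: P_scale scaleC_add_right scaleC_scaleC mult.commute)

lemma B_diff: "B (x - y) = B x - B y"
  using B_add[of "x - y" y] by simp

lemma norm_B_le: "norm (B x) \<le> norm (P x) * (1 / Im z)"
  using norm_shift_ge[OF B_in[of x]] Im_pos by (simp add: field_simps)

lemma bounded_linear_B: "bounded_linear B"
proof (rule bounded_linear_intro[where K = "1 / Im z"])
  show "B (r *\<^sub>R x) = r *\<^sub>R B x" for r x using B_scale[of "complex_of_real r"] by (simp add: scaleC_of_real)
  show "norm (B x) \<le> norm x * (1 / Im z)" for x
    using norm_B_le[of x] mult_right_mono[OF norm_P_le[of x], of "1 / Im z"] Im_pos by simp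
qed (simp add: B_add)

lemma continuous_on_B [continuous_intros]: "continuous_on A f \<Longrightarrow> continuous_on A (\<lambda>x. B (f x))"
  by (rule bounded_linear.continuous_on[OF bounded_linear_B])

section \<open>Scaling the defect space\<close>

definition V where "V c x = P x + c *\<^sub>C (x - P x)"

lemma defect_scaling_eq: "defect_scaling S z c = V c"
  unfolding defect_scaling_def defect_space_def V_def P_def
  using orth_proj_orth_compl[OF closed_M csubspace_M] by (simp add: M_def)

lemma P_V [simp]: "P (V c x) = P x"
  by (simp add: V_def P_add P_diff P_scale)

lemma V_V: "V a (V b x) = V (a * b) x"
  by (simp add: V_def[of a "V b x"]) (simp add: V_def scaleC_scaleC)

lemma V_1 [simp]: "V 1 x = x"
  by (simp add: V_def scaleC_one)

lemma V_inverse: "c \<noteq> 0 \<Longrightarrow> V (1 / c) (V c x) = x" "c \<noteq> 0 \<Longrightarrow> V c (V (1 / c) x) = x"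
  by (simp_all add: V_V)

lemma V_add: "V c (x + y) = V c x + V c y"
  by (simp add: V_def P_add scaleC_add_right complex_vector.scale_right_diff_distrib algebra_simps)

lemma V_scale: "V c (a *\<^sub>C x) = a *\<^sub>C V c x"
  by (simp add: V_def P_scale scaleC_add_right complex_vector.scale_right_diff_distrib scaleC_scaleC
      mult.commute)

lemma continuous_on_V [continuous_intros]: "continuous_on A f \<Longrightarrow> continuous_on A (\<lambda>x. V c (f x))"
  unfolding V_def by (intro continuous_intros)

text \<open>Scaling the defect component changes the form only on the defect components, since \<open>V\<close>
  preserves the orthogonal decomposition.\<close>

lemma cinner_V: "cinner (V a x) (V b y) = cinner x y + (a * cnj b - 1) * cinner (x - P x) (y - P y)"
proof -
  have orth: "cinner (u - P u) (P v) = 0" "cinner (P v) (u - P u) = 0" for u v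
  proof -
    show "cinner (u - P u) (P v) = 0" using P_orthogonal[of u] P_in[of v] by (simp add: orth_compl_def)
    then show "cinner (P v) (u - P u) = 0" by (metis cinner_commute complex_cnj_zero)
  qed
  have V: "cinner (V a x) (V b y) = cinner (P x) (P y) + a * cnj b * cinner (x - P x) (y - P y)" for a b
    unfolding V_def
    by (simp add: cinner_add_left cinner_add_right cinner_scaleC_left cinner_scaleC_right orth mult.commute)
  from V[of 1 1] V[of a b] show ?thesis by (simp add: algebra_simps)
qed

section \<open>Moving the spectral point\<close>

text \<open>The compression to \<open>M\<close> of the Cayley transform \<open>(S - z) (S - cnj z)\<^sup>-\<^sup>1 = 1 - (z - cnj z) B\<close>.\<close>

definition U where "U x = P (P x - (z - cnj z) *\<^sub>C B x)"

lemma norm_U_le: "norm (U x) \<le> norm (P x)"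
proof -
  let ?g = "P x + cnj z *\<^sub>C B x"
  have "norm (?g - z *\<^sub>C B x) = norm (?g - cnj z *\<^sub>C B x)"
    using norm_shift[OF symmetric B_in, of x z] norm_shift[OF symmetric B_in, of x "cnj z"]
    by - (rule power2_eq_imp_eq, auto)
  moreover have "?g - z *\<^sub>C B x = P x - (z - cnj z) *\<^sub>C B x"
    by (simp add: complex_vector.scale_left_diff_distrib)
  ultimately show ?thesis using norm_P_le[of "P x - (z - cnj z) *\<^sub>C B x"] by (simp add: U_def)
qed

lemma U_diff: "U x - U y = U (x - y)"
  by (simp add: U_def P_diff B_diff P_scale complex_vector.scale_right_diff_distrib)

end

locale spectral_shift = shifted_symmetric_operator +
  fixes \<mu> :: complex
  assumes Im_mu: "Im \<mu> > 0"
begin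

definition w where "w = cnj \<mu> - cnj z"
definition W where "W f = f - w *\<^sub>C B f"

text \<open>A point of the upper half-plane is closer to \<open>\<mu>\<close> than to \<open>cnj \<mu>\<close>.\<close>

lemma norm_w_less: "cmod w < cmod (z - cnj \<mu>)"
proof -
  have "(Im z - Im \<mu>)\<^sup>2 < (Im z + Im \<mu>)\<^sup>2"
    using mult_pos_pos[OF Im_pos Im_mu] by (simp add: power2_eq_square algebra_simps)
  then have "(cmod w)\<^sup>2 < (cmod (z - cnj \<mu>))\<^sup>2"
    by (simp add: w_def cmod_power2 power2_commute)
  then show ?thesis by (rule power2_less_imp_less) simp
qed

text \<open>The component of \<open>W f\<close> in \<open>M\<close> depends on that of \<open>f\<close> alone, through a contractive perturbation
  of a nonzero multiple of the identity.\<close>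

lemma P_W: "(z - cnj \<mu>) *\<^sub>C P f + w *\<^sub>C U f = (z - cnj z) *\<^sub>C P (W f)"
proof -
  have "(z - cnj \<mu>) *\<^sub>C P f + w *\<^sub>C P f = (z - cnj z) *\<^sub>C P f"
    by (simp add: scaleC_add_left[symmetric] w_def)
  then show ?thesis
    by (simp add: U_def W_def P_diff P_scale complex_vector.scale_right_diff_distrib
        scaleC_scaleC mult.commute add_diff_eq)
qed

text \<open>The equation \<open>W f = x\<close> is triangular: its component in \<open>M\<close> determines \<open>y = P f\<close>, and then
  \<open>B f = B y\<close> gives \<open>f = x + w B y\<close>.\<close>

lemma W_surj: "\<exists>f. W f = x"
proof -
  have "norm (U x - U y) \<le> norm (x - y)" for x y
    using norm_U_le[of "x - y"] norm_P_le[of "x - y"] by (simp add: U_diff)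
  then obtain y where y: "(z - cnj \<mu>) *\<^sub>C y + w *\<^sub>C U y = (z - cnj z) *\<^sub>C P x"
    using perturbed_identity_surj[OF _ norm_w_less] by blast
  have z: "z - cnj \<mu> \<noteq> 0" "z - cnj z \<noteq> 0" using Im_pos Im_mu by (auto simp: complex_eq_iff)
  \<comment> \<open>The solution \<open>y\<close> lies in \<open>M\<close> because every other term of its equation does.\<close>
  have "(z - cnj \<mu>) *\<^sub>C y = (z - cnj z) *\<^sub>C P x - w *\<^sub>C U y" using y by (simp add: eq_diff_eq)
  also have "\<dots> = P ((z - cnj \<mu>) *\<^sub>C y)"
    using calculation by (simp add: P_diff P_scale U_def)
  finally have Py: "P y = y" using z by (simp add: P_scale)
  have "(z - cnj z) *\<^sub>C P (W y) = (z - cnj z) *\<^sub>C P x"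
    using P_W[of y] unfolding Py y by (rule sym)
  then have PW: "P (W y) = P x" using z by simp
  define f where "f = x + w *\<^sub>C B y"
  have "P f = y" using PW Py by (simp add: f_def W_def P_add P_diff P_scale diff_eq_eq)
  then have "B f = B y" using B_P by metis
  then show ?thesis by (auto simp: f_def W_def intro!: exI[of _ f])
qed

lemma W_bounded_below: "\<exists>K. \<forall>f. norm f \<le> norm (W f) * K"
proof -
  define \<delta> where "\<delta> = cmod (z - cnj \<mu>) - cmod w"
  define c where "c = cmod (z - cnj z)"
  have \<delta>: "\<delta> > 0" using norm_w_less by (simp add: \<delta>_def)
  have "norm f \<le> norm (W f) * (1 + cmod w * (c / \<delta>) / Im z)" for f
  proof -
    have "cmod (z - cnj \<mu>) * norm (P f) - cmod w * norm (U f) \<le> c * norm (P (W f))"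
      using norm_diff_ineq[of "(z - cnj \<mu>) *\<^sub>C P f" "w *\<^sub>C U f"]
      by (simp add: P_W norm_scaleC c_def)
    moreover have "cmod w * norm (U f) \<le> cmod w * norm (P f)"
      by (simp add: mult_left_mono norm_U_le)
    moreover have "c * norm (P (W f)) \<le> c * norm (W f)"
      by (simp add: mult_left_mono norm_P_le c_def)
    ultimately have "\<delta> * norm (P f) \<le> c * norm (W f)" by (simp add: \<delta>_def left_diff_distrib)
    then have Pf: "norm (P f) \<le> c / \<delta> * norm (W f)" using \<delta> by (simp add: field_simps)
    have "norm f \<le> norm (W f) + cmod w * norm (B f)"
      using norm_triangle_ineq[of "W f" "w *\<^sub>C B f"] by (simp add: W_def norm_scaleC)
    also have "\<dots> \<le> norm (W f) + cmod w * ((c / \<delta> * norm (W f)) / Im z)"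
      using order_trans[OF norm_B_le[of f]] divide_right_mono[OF Pf, of "Im z"] Im_pos
      by (intro add_left_mono mult_left_mono) auto
    finally show ?thesis by (simp add: algebra_simps)
  qed
  then show ?thesis by blast
qed

lemma W_diff: "W x - W y = W (x - y)"
  by (simp add: W_def B_diff complex_vector.scale_right_diff_distrib)

lemma continuous_on_W [continuous_intros]: "continuous_on A f \<Longrightarrow> continuous_on A (\<lambda>x. W (f x))"
  unfolding W_def by (intro continuous_intros)

definition W' where "W' x = (SOME f. W f = x)"

lemma W_W' [simp]: "W (W' x) = x"
  unfolding W'_def by (rule someI_ex[OF W_surj])

lemma W_inj: "inj W"
proof (rule injI)
  fix x y assume "W x = W y"
  moreover obtain K where "norm (x - y) \<le> norm (W (x - y)) * K" using W_bounded_below by blast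
  ultimately show "x = y" by (simp flip: W_diff)
qed

lemma W'_W [simp]: "W' (W x) = x"
  using W_inj W_W' by (metis injD)

lemma continuous_on_W' [continuous_intros]:
  "continuous_on A f \<Longrightarrow> continuous_on A (\<lambda>x. W' (f x))"
proof -
  obtain K where K: "\<And>f. norm f \<le> norm (W f) * K" using W_bounded_below by blast
  have "continuous_on UNIV W'"
  proof (rule lipschitz_on_continuous_on[of "\<bar>K\<bar>"], rule lipschitz_onI)
    fix x y
    have "W (W' x - W' y) = x - y" by (simp flip: W_diff)
    then have "norm (W' x - W' y) \<le> norm (x - y) * K" using K by metis
    also have "\<dots> \<le> norm (x - y) * \<bar>K\<bar>" by (simp add: mult_left_mono)
    finally show "dist (W' x) (W' y) \<le> \<bar>K\<bar> * dist x y" by (simp add: dist_norm mult.commute)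
  qed simp
  then show "continuous_on A f \<Longrightarrow> continuous_on A (\<lambda>x. W' (f x))"
    by (rule continuous_on_compose2) auto
qed

text \<open>The set \<open>(V c)\<^sup>-\<^sup>1 (dom T\<^sup>2)\<close> for the transformed operator \<open>T\<close>, written in terms of \<open>S\<close>.\<close>

definition pulled_back_dom_square where
  "pulled_back_dom_square = {f. \<exists>g. (f, g) \<in> S \<and> g + w *\<^sub>C (f - P f) \<in> Domain S}"

text \<open>On the graph of \<open>S\<close> this is \<open>(f, S f) \<mapsto> (W f, S (W f))\<close>, because \<open>S B = cnj z B + P\<close>. The formula
  makes sense, and is invertible and continuous, on the whole product space.\<close>

definition W_graph where
  "W_graph p = (W (fst p), snd p - (w * cnj z) *\<^sub>C B (fst p) - w *\<^sub>C P (fst p))"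

definition W_graph' where
  "W_graph' p = (W' (fst p),
     snd p + (w * cnj z) *\<^sub>C B (W' (fst p)) + w *\<^sub>C P (W' (fst p)))"

lemma W_graph_image: "W_graph ` S = S"
proof -
  have B: "((w *\<^sub>C B f), (w * cnj z) *\<^sub>C B f + w *\<^sub>C P f) \<in> S" for f
    using graph_scale[OF B_in[of f], of w] by (simp add: scaleC_add_right scaleC_scaleC add.commute)
  have "W_graph p \<in> S" if "p \<in> S" for p
    using graph_diff[OF _ B[of "fst p"], of "fst p" "snd p"] that
    by (simp add: W_graph_def W_def diff_diff_add)
  moreover have "\<exists>q \<in> S. p = W_graph q" if "p \<in> S" for p
  proof (rule bexI)
    show "p = W_graph (W_graph' p)" by (simp add: W_graph_def W_graph'_def)
    have "W' (fst p) = fst p + w *\<^sub>C B (W' (fst p))"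
      using W_W'[of "fst p"] unfolding W_def by (simp add: diff_eq_eq)
    then show "W_graph' p \<in> S"
      using graph_add[OF _ B[of "W' (fst p)"], of "fst p" "snd p"] that
      by (simp add: W_graph'_def add.assoc)
  qed
  ultimately show ?thesis by blast
qed

text \<open>By \<open>W_graph\<close>, the condition \<open>S (W f) \<in> dom S\<close> differs from \<open>S f + w (1 - P) f \<in> dom S\<close> only by a
  vector of \<open>dom S\<close>, and \<open>W\<close> maps \<open>dom S\<close> onto itself.\<close>

lemma dom_square_eq: "dom_square S = W ` pulled_back_dom_square"
proof -
  have iff: "snd (W_graph (f, g)) \<in> Domain S \<longleftrightarrow> g + w *\<^sub>C (f - P f) \<in> Domain S"
    if "(f, g) \<in> S" for f g
  proof -
    define r where "r = w *\<^sub>C f + (w * cnj z) *\<^sub>C B f"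
    \<comment> \<open>The correction is irrelevant for membership since \<open>f\<close> and \<open>B f\<close> are in the domain.\<close>
    have r: "r \<in> Domain S"
      using graph_add[OF graph_scale[OF that, of w] graph_scale[OF B_in[of f], of "w * cnj z"]] by (auto simp: r_def)
    have eq: "g + w *\<^sub>C (f - P f) = snd (W_graph (f, g)) + r"
      by (simp add: W_graph_def r_def complex_vector.scale_right_diff_distrib algebra_simps)
    have "x + r \<in> Domain S \<longleftrightarrow> x \<in> Domain S" for x
    proof -
      have "(x, g - g') \<in> S" if "(x + r, g) \<in> S" "(r, g') \<in> S" for g g'
        using graph_diff[OF that] by simp
      then show ?thesis using r graph_add by blast
    qed
    then show ?thesis using eq by simp
  qed
  have "dom_square S = fst ` {p \<in> S. snd p \<in> Domain S}"
    by (force simp: dom_square_def)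
  also have "\<dots> = fst ` {p \<in> W_graph ` S. snd p \<in> Domain S}" by (simp add: W_graph_image)
  also have "\<dots> = fst ` W_graph ` {p \<in> S. snd (W_graph p) \<in> Domain S}" by blast
  also have "{p \<in> S. snd (W_graph p) \<in> Domain S} = {(f, g). (f, g) \<in> S \<and> g + w *\<^sub>C (f - P f) \<in> Domain S}"
    using iff by auto
  also have "fst ` W_graph ` \<dots> = W ` pulled_back_dom_square"
    by (force simp: W_graph_def pulled_back_dom_square_def)
  finally show ?thesis .
qed

section \<open>The transformed operator\<close>

definition c where "c = complex_of_real (sqrt (Im z / Im \<mu>))"
definition T where "T = transformed_operator S \<mu> z"
definition c' where "c' = cnj \<mu> / cnj z * c"
definition V_graph where "V_graph p = (V c (fst p), V c' (snd p))"
definition V_graph' where "V_graph' p = (V (1 / c) (fst p), V (1 / c') (snd p))"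

lemma nonzero: "c \<noteq> 0" "c' \<noteq> 0" "cnj z \<noteq> 0"
proof -
  show c: "c \<noteq> 0" using Im_pos Im_mu by (simp add: c_def)
  have "z \<noteq> 0" "\<mu> \<noteq> 0" using Im_pos Im_mu by auto
  then show "c' \<noteq> 0" "cnj z \<noteq> 0" using c by (auto simp: c'_def)
qed

lemma T_eq: "T = V_graph ` S"
  unfolding T_def transformed_operator_def defect_scaling_eq c_def[symmetric] c'_def[symmetric]
  by (force simp: V_graph_def)

lemma V_graph_inverse: "V_graph' (V_graph p) = p" "V_graph (V_graph' p) = p"
  by (simp_all add: V_graph_def V_graph'_def V_inverse nonzero)

lemma V_graph_continuous: "continuous_on UNIV V_graph" "continuous_on UNIV V_graph'"
  unfolding V_graph_def V_graph'_def by (intro continuous_intros)+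

lemma V_inj: "inj (V c)"
  using V_inverse(1)[OF nonzero(1)] by (metis injI)

lemma linear_T: "linear_operator T"
  unfolding linear_operator_def
proof
  show "single_valued T"
    unfolding single_valued_def T_eq V_graph_def by (auto dest!: injD[OF V_inj] dest: graph_single)
  have "V_graph p + V_graph q = V_graph (p + q)" for p q by (simp add: V_graph_def V_add)
  moreover have "a *\<^sub>C V_graph p = V_graph (a *\<^sub>C p)" for a p
    by (simp add: V_graph_def V_scale scaleC_prod_def)
  moreover have "0 = V_graph 0"
    using V_scale[of _ 0 0] by (simp add: V_graph_def zero_prod_def)
  moreover have "csubspace S" using linear by (simp add: linear_operator_def)
  ultimately show "csubspace T"
    unfolding T_eq complex_vector.subspace_def by (safe; simp only:; blast)
qed

lemma closed_T: "closed T"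
proof -
  have "closure T = T"
    unfolding T_eq closure_homeomorphic_image[OF V_graph_continuous V_graph_inverse]
    using closed by simp
  then show ?thesis by (metis closed_closure)
qed

lemma Domain_T: "Domain T = V c ` Domain S"
  by (force simp: T_eq V_graph_def)

lemmas V_c_homeomorphism = continuous_on_V[OF continuous_on_id, of UNIV c]
  continuous_on_V[OF continuous_on_id, of UNIV "1 / c"] V_inverse[OF nonzero(1)]

lemma dense_V_image: "dense (V c ` D) \<longleftrightarrow> dense D"
  using dense_homeomorphic_image[OF V_c_homeomorphism] .

text \<open>By \<open>defect_part_of_image\<close>, the failure of symmetry on the defect components is
  \<open>(z - cnj z) - \<bar>c\<bar>\<^sup>2 (\<mu> - cnj \<mu>)\<close>; the value of \<open>c\<close> is chosen to make it vanish.\<close>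

lemma symmetric_T: "symmetric_operator T"
proof -
  have cc: "c * cnj c * (\<mu> - cnj \<mu>) = z - cnj z"
    using Im_pos Im_mu by (simp add: c_def complex_eq_iff flip: of_real_mult)
  have "cinner (V c' g) (V c f') = cinner (V c f) (V c' g')"
    if S: "(f, g) \<in> S" "(f', g') \<in> S" for f g f' g'
  proof -
    have sym: "cinner g f' = cinner f g'" using symmetric S by (auto simp: symmetric_operator_def)
    let ?q = "cinner (f - P f) (f' - P f')"
    have "(c' * cnj c - 1) * cnj z - (c * cnj c' - 1) * z = z - cnj z - c * cnj c * (\<mu> - cnj \<mu>)"
      using nonzero(3) by (simp add: c'_def field_simps)
    then have "(c' * cnj c - 1) * (cnj z * ?q) = (c * cnj c' - 1) * (z * ?q)"
      using cc by (metis diff_self eq_iff_diff_eq_0 mult.assoc)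
    then show ?thesis
      by (simp add: cinner_V sym defect_part_of_image[OF S(1)] defect_part_of_image[OF S(2)]
          cinner_scaleC_left cinner_scaleC_right)
  qed
  then show ?thesis unfolding symmetric_operator_def T_eq V_graph_def by auto
qed

text \<open>As \<open>c' = (cnj \<mu> / cnj z) c\<close>, the vector \<open>V c' (S f)\<close> lies in \<open>V c (dom S)\<close> iff
  \<open>V (cnj \<mu> / cnj z) (S f)\<close> lies in \<open>dom S\<close>, and the latter vector is \<open>S f + w (1 - P) f\<close>.\<close>

lemma dom_square_T: "dom_square T = V c ` pulled_back_dom_square"
proof -
  have iff: "V c' g \<in> Domain T \<longleftrightarrow> g + w *\<^sub>C (f - P f) \<in> Domain S" if "(f, g) \<in> S" for f g
  proof -
    have "V c' g = V c (V (cnj \<mu> / cnj z) g)" by (simp add: V_V c'_def mult.commute)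
    moreover have "V (cnj \<mu> / cnj z) g = g + w *\<^sub>C (f - P f)"
    proof -
      have "V (cnj \<mu> / cnj z) g = g + (cnj \<mu> / cnj z - 1) *\<^sub>C (g - P g)"
        by (simp add: V_def complex_vector.scale_left_diff_distrib scaleC_one)
      also have "\<dots> = g + w *\<^sub>C (f - P f)"
      proof -
        have "(cnj \<mu> / cnj z - 1) * cnj z = w"
          using nonzero(3) by (simp add: w_def left_diff_distrib)
        then show ?thesis by (simp add: defect_part_of_image[OF that] scaleC_scaleC)
      qed
      finally show ?thesis .
    qed
    ultimately show ?thesis by (simp add: Domain_T inj_image_mem_iff[OF V_inj])
  qed
  have "dom_square T = V c ` {f. \<exists>g. (f, g) \<in> S \<and> V c' g \<in> Domain T}"
    unfolding dom_square_def by (subst T_eq) (force simp: V_graph_def)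
  also have "{f. \<exists>g. (f, g) \<in> S \<and> V c' g \<in> Domain T} = pulled_back_dom_square"
    unfolding pulled_back_dom_square_def using iff by blast
  finally show ?thesis .
qed

lemma is_core_dom_square_T: "is_core (dom_square T) T \<longleftrightarrow> is_core (dom_square S) S"
proof -
  have "is_core (dom_square T) T \<longleftrightarrow> S \<subseteq> closure (graph_restrict S (pulled_back_dom_square))"
    unfolding is_core_dom_square[OF linear_T] unfolding dom_square_T unfolding T_eq
    by (rule graph_dense_homeomorphic_image[OF V_graph_continuous V_graph_inverse _ V_inj])
      (simp add: V_graph_def)
  moreover have "is_core (dom_square S) S \<longleftrightarrow> S \<subseteq> closure (graph_restrict S (pulled_back_dom_square))"
  proof -
    have "continuous_on UNIV (W_graph)" "continuous_on UNIV (W_graph')"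
      unfolding W_graph_def W_graph'_def
      by (intro continuous_intros)+
    moreover have "W_graph' (W_graph p) = p" "W_graph (W_graph' p) = p" for p
      by (simp_all add: W_graph_def W_graph'_def)
    ultimately have "W_graph ` S \<subseteq> closure (graph_restrict (W_graph ` S) (W ` pulled_back_dom_square))
        \<longleftrightarrow> S \<subseteq> closure (graph_restrict S (pulled_back_dom_square))"
      by (rule graph_dense_homeomorphic_image[OF _ _ _ _ _ W_inj])
        (simp add: W_graph_def)
    then show ?thesis
      unfolding is_core_dom_square[OF linear] by (simp add: dom_square_eq W_graph_image)
  qed
  ultimately show ?thesis by simp
qed

lemma dense_dom_square_T: "dense (dom_square T) \<longleftrightarrow> dense (dom_square S)"
proof -
  have "dense (W ` pulled_back_dom_square) \<longleftrightarrow> dense (pulled_back_dom_square)"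
    by (rule dense_homeomorphic_image[of _ "W'"])
      (auto intro!: continuous_intros)
  then show ?thesis by (simp add: dom_square_T dense_V_image dom_square_eq)
qed

lemma dom_square_T_trivial: "dom_square T = {0} \<longleftrightarrow> dom_square S = {0}"
proof -
  have "V c 0 = 0" using V_scale[of c 0 0] by simp
  then have "V c ` D = {0} \<longleftrightarrow> D = {0}" for D
    using inj_image_eq_iff[OF V_inj, of D "{0}"] by simp
  moreover have "W 0 = 0" using W_diff[of 0 0] by simp
  then have "W ` D = {0} \<longleftrightarrow> D = {0}" for D
    using inj_image_eq_iff[OF W_inj, of D "{0}"] by simp
  ultimately show ?thesis by (simp add: dom_square_T dom_square_eq)
qed

end


theorem theorem10p2:
  fixes S :: "'a :: chilbert_space operator"
  assumes "linear_operator S" and "closed S" and "dense (Domain S)" and "symmetric_operator S"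
    and "upper_deficiency_index S \<noteq> 0"
  shows "(\<forall>\<mu> \<in> upper_half_plane. \<forall>z \<in> upper_half_plane.
            linear_operator (transformed_operator S \<mu> z) \<and>
            symmetric_operator (transformed_operator S \<mu> z) \<and>
            dense (Domain (transformed_operator S \<mu> z)) \<and>
            closed (transformed_operator S \<mu> z)) \<and>

         (((\<exists>\<mu> \<in> upper_half_plane. \<exists>z \<in> upper_half_plane.
              is_core (dom_square (transformed_operator S \<mu> z)) (transformed_operator S \<mu> z)) \<longleftrightarrow>
           (\<forall>\<mu> \<in> upper_half_plane. \<forall>z \<in> upper_half_plane.
              is_core (dom_square (transformed_operator S \<mu> z)) (transformed_operator S \<mu> z))) \<and>
          ((\<forall>\<mu> \<in> upper_half_plane. \<forall>z \<in> upper_half_plane.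
              is_core (dom_square (transformed_operator S \<mu> z)) (transformed_operator S \<mu> z)) \<longleftrightarrow>
           is_core (dom_square S) S)) \<and>

         (((\<exists>\<mu> \<in> upper_half_plane. \<exists>z \<in> upper_half_plane.
              dense (dom_square (transformed_operator S \<mu> z)) \<and>
              \<not> is_core (dom_square (transformed_operator S \<mu> z)) (transformed_operator S \<mu> z)) \<longleftrightarrow>
           (\<forall>\<mu> \<in> upper_half_plane. \<forall>z \<in> upper_half_plane.
              dense (dom_square (transformed_operator S \<mu> z)) \<and>
              \<not> is_core (dom_square (transformed_operator S \<mu> z)) (transformed_operator S \<mu> z))) \<and>
          ((\<forall>\<mu> \<in> upper_half_plane. \<forall>z \<in> upper_half_plane.
              dense (dom_square (transformed_operator S \<mu> z)) \<and>
              \<not> is_core (dom_square (transformed_operator S \<mu> z)) (transformed_operator S \<mu> z)) \<longleftrightarrow>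
           dense (dom_square S) \<and> \<not> is_core (dom_square S) S)) \<and>

         (((\<exists>\<mu> \<in> upper_half_plane. \<exists>z \<in> upper_half_plane.
              \<not> dense (dom_square (transformed_operator S \<mu> z))) \<longleftrightarrow>
           (\<forall>\<mu> \<in> upper_half_plane. \<forall>z \<in> upper_half_plane.
              \<not> dense (dom_square (transformed_operator S \<mu> z)))) \<and>
          ((\<forall>\<mu> \<in> upper_half_plane. \<forall>z \<in> upper_half_plane.
              \<not> dense (dom_square (transformed_operator S \<mu> z))) \<longleftrightarrow>
           \<not> dense (dom_square S))) \<and>

         (((\<exists>\<mu> \<in> upper_half_plane. \<exists>z \<in> upper_half_plane.
              dom_square (transformed_operator S \<mu> z) = {0}) \<longleftrightarrow>
           (\<forall>\<mu> \<in> upper_half_plane. \<forall>z \<in> upper_half_plane.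
              dom_square (transformed_operator S \<mu> z) = {0})) \<and>
          ((\<forall>\<mu> \<in> upper_half_plane. \<forall>z \<in> upper_half_plane.
              dom_square (transformed_operator S \<mu> z) = {0}) \<longleftrightarrow>
           dom_square S = {0}))"
proof -
  have T: "linear_operator (transformed_operator S \<mu> z) \<and>
      symmetric_operator (transformed_operator S \<mu> z) \<and>
      dense (Domain (transformed_operator S \<mu> z)) \<and>
      closed (transformed_operator S \<mu> z)"
    and core: "is_core (dom_square (transformed_operator S \<mu> z)) (transformed_operator S \<mu> z)
      \<longleftrightarrow> is_core (dom_square S) S"
    and dense: "dense (dom_square (transformed_operator S \<mu> z)) \<longleftrightarrow> dense (dom_square S)"
    and trivial: "dom_square (transformed_operator S \<mu> z) = {0} \<longleftrightarrow> dom_square S = {0}"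
    if "\<mu> \<in> upper_half_plane" "z \<in> upper_half_plane" for \<mu> z
  proof -
    have Im: "Im \<mu> > 0" "Im z > 0" using that by (auto simp: upper_half_plane_def)
    interpret spectral_shift S z \<mu> by unfold_locales (fact assms Im)+
    note T = T_def
    show "linear_operator (transformed_operator S \<mu> z) \<and>
        symmetric_operator (transformed_operator S \<mu> z) \<and>
        dense (Domain (transformed_operator S \<mu> z)) \<and>
        closed (transformed_operator S \<mu> z)"
      using linear_T symmetric_T closed_T Domain_T
        dense_V_image assms(3) unfolding T by simp
    show "is_core (dom_square (transformed_operator S \<mu> z)) (transformed_operator S \<mu> z)
        \<longleftrightarrow> is_core (dom_square S) S"
      using is_core_dom_square_T unfolding T .
    show "dense (dom_square (transformed_operator S \<mu> z)) \<longleftrightarrow> dense (dom_square S)"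
      using dense_dom_square_T unfolding T .
    show "dom_square (transformed_operator S \<mu> z) = {0} \<longleftrightarrow> dom_square S = {0}"
      using dom_square_T_trivial unfolding T .
  qed
  have "\<i> \<in> upper_half_plane" by (simp add: upper_half_plane_def)
  then have const: "((\<exists>\<mu>\<in>upper_half_plane. \<exists>z\<in>upper_half_plane. p \<mu> z) \<longleftrightarrow>
        (\<forall>\<mu>\<in>upper_half_plane. \<forall>z\<in>upper_half_plane. p \<mu> z)) \<and>
      ((\<forall>\<mu>\<in>upper_half_plane. \<forall>z\<in>upper_half_plane. p \<mu> z) \<longleftrightarrow> q)"
    if "\<And>\<mu> z. \<mu> \<in> upper_half_plane \<Longrightarrow> z \<in> upper_half_plane \<Longrightarrow> p \<mu> z \<longleftrightarrow> q" for p q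
    using that by blast
  show ?thesis
    by (rule conjI[OF _ conjI[OF const conjI[OF const conjI[OF const const]]]])
      (simp_all add: T core dense trivial)
qed

end
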